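(* Let $G$ be a finite connected graph of order $n$, minimum degree $\delta$, maximum degree $\Delta$ and domination number $\gamma(G)$. Then $$\gamma_{s}(G)\geq -n+2\max\left\{\left\lceil\frac{\Delta+2}{2}\right\rceil,\ \left\lceil\frac{\delta+2\gamma(G)}{2}\right\rceil\right\}.$$ Moreover, the bound is sharp: equality holds for every complete graph $K_n$.
   Context: A signed dominating function (SDF) of $G$ is a function $f:V(G)\to\{-1,1\}$ with $f(N[v])=\sum_{u\in N[v]}f(u)\geq 1$ for every vertex $v$, where $N[v]$ is the closed neighborhood; $\gamma_s(G)$ is the minimum of $\sum_{v} f(v)$ over all SDFs. $\gamma(G)$ is the minimum cardinality of a dominating set (a set $D$ such that every vertex outside $D$ has a neighbor in $D$). *)

theory Defs
  imports Complex_Main "Graph_Theory.Graph_Theory"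
begin

text \<open>
  A finite simple undirected graph is a digraph satisfying the locale predicate \<^const>\<open>graph\<close>:
  finite, loop-free, without parallel arcs and symmetric, every undirected edge being a pair of
  opposite arcs. Accordingly the degree of a vertex is its \<^const>\<open>out_degree\<close>. The library's
  \<^const>\<open>connected\<close> includes nonemptiness of the vertex set.
\<close>

definition closed_nbhd :: "('a, 'b) pre_digraph \<Rightarrow> 'a \<Rightarrow> 'a set" where
  "closed_nbhd G v = insert v {u \<in> verts G. (v, u) \<in> arcs_ends G}"

definition min_degree :: "('a, 'b) pre_digraph \<Rightarrow> nat" where
  "min_degree G = Min (out_degree G ` verts G)"

definition max_degree :: "('a, 'b) pre_digraph \<Rightarrow> nat" where
  "max_degree G = Max (out_degree G ` verts G)"

definition dominating_set :: "('a, 'b) pre_digraph \<Rightarrow> 'a set \<Rightarrow> bool" where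
  "dominating_set G D \<longleftrightarrow>
     D \<subseteq> verts G \<and> (\<forall>v \<in> verts G - D. \<exists>u \<in> D. (v, u) \<in> arcs_ends G)"

definition domination_number :: "('a, 'b) pre_digraph \<Rightarrow> nat" where
  "domination_number G = Min (card ` {D. dominating_set G D})"

definition signed_dominating_function :: "('a, 'b) pre_digraph \<Rightarrow> ('a \<Rightarrow> int) \<Rightarrow> bool" where
  "signed_dominating_function G f \<longleftrightarrow>
     (\<forall>v \<in> verts G. f v \<in> {-1, 1}) \<and>
     (\<forall>v \<in> verts G. (\<Sum>u \<in> closed_nbhd G v. f u) \<ge> 1)"

text \<open>
  For a finite graph both minima range over finite nonempty sets: the whole vertex set is dominating,
  the constant function 1 is signed dominating, and the weight of a signed dominating function lies
  between minus the order and the order (values off the vertex set do not matter).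
\<close>

definition signed_domination_number :: "('a, 'b) pre_digraph \<Rightarrow> int" where
  "signed_domination_number G =
     Min ((\<lambda>f. \<Sum>v \<in> verts G. f v) ` {f. signed_dominating_function G f})"

end

theory Submission
  imports Defs
begin

text \<open>
  If \<open>P\<close> is the set of vertices on which a signed dominating function \<open>f\<close> is positive, then \<open>f\<close> has
  weight \<open>2 |P| - n\<close>, and every vertex \<open>v\<close> satisfies \<open>2 |N[v] \<inter> P| \<ge> deg v + 2\<close>. A vertex of maximum
  degree gives \<open>2 |P| \<ge> \<Delta> + 2\<close>. Moreover, every closed neighbourhood meets \<open>P\<close> in more than
  \<open>k = \<lceil>\<delta> / 2\<rceil>\<close> vertices, so deleting any \<open>k\<close> vertices from \<open>P\<close> leaves a dominating set, whence
  \<open>|P| \<ge> \<gamma>(G) + k\<close>. In a complete graph all closed neighbourhoods are the whole vertex set, and any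
  \<open>f\<close> with \<open>\<lfloor>n / 2\<rfloor> + 1\<close> positive values attains the bound.
\<close>

lemma sum_sign_eq_card:
  fixes f :: "'a \<Rightarrow> int"
  assumes "finite A" and "\<And>x. x \<in> A \<Longrightarrow> f x \<in> {-1, 1}"
  shows "sum f A = 2 * int (card {x \<in> A. f x = 1}) - int (card A)"
proof -
  have "sum f A = (\<Sum>x\<in>A. 2 * (if f x = 1 then 1 else 0) - 1)"
    using assms(2) by (intro sum.cong) auto
  also have "\<dots> = 2 * (\<Sum>x\<in>A. if f x = 1 then 1 else 0) - int (card A)"
    by (simp add: sum_subtractf sum_distrib_left)
  also have "(\<Sum>x\<in>A. if f x = 1 then 1 else 0) = int (card {x \<in> A. f x = 1})"
    using assms(1) by (simp add: sum.If_cases Int_def)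
  finally show ?thesis .
qed

lemma ceiling_half_le:
  assumes "a \<le> 2 * p"
  shows "\<lceil>real a / 2\<rceil> \<le> int p"
  using assms by (simp add: ceiling_le_iff)

text \<open>Writing \<open>n = 2q + r\<close> gives \<open>(n + 1) / 2 = q + (r + 1) / 2\<close>,
  whose last summand is 1/2 or 1. Used for complete graphs, where the maximum degree plus 2 is
  \<open>n + 1\<close>.\<close>

lemma ceiling_Suc_half: "\<lceil>(real n + 1) / 2\<rceil> = int (n div 2 + 1)"
proof (rule ceiling_unique)
  have "n = 2 * (n div 2) + n mod 2" by simp
  then have n: "real n = 2 * real (n div 2) + real (n mod 2)"
    by (metis of_nat_add of_nat_mult of_nat_numeral)
  have "n mod 2 < 2" by simp
  then have "real (n mod 2) \<le> 1" by linarith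
  then show "(real n + 1) / 2 \<le> of_int (int (n div 2 + 1))"
    using n by simp
  show "of_int (int (n div 2 + 1)) - 1 < (real n + 1) / 2"
    using n by simp
qed

context digraph
begin

lemma closed_nbhd_subset_verts: "v \<in> verts G \<Longrightarrow> closed_nbhd G v \<subseteq> verts G"
  by (auto simp: closed_nbhd_def)

lemma finite_closed_nbhd [simp]: "finite (closed_nbhd G v)"
  by (simp add: closed_nbhd_def)

text \<open>\<open>out_degree\<close> counts arcs: without parallel arcs \<open>head\<close> is
  injective on them, and without loops \<open>v\<close> is not among their heads, so it contributes
  the extra 1.\<close>

lemma card_closed_nbhd: "card (closed_nbhd G v) = out_degree G v + 1"
proof -
  have "{u \<in> verts G. (v, u) \<in> arcs_ends G} = head G ` out_arcs G v"
    by (auto simp: arcs_ends_conv)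
  moreover have "inj_on (head G) (out_arcs G v)"
    by (rule inj_onI) (auto intro: no_multi_arcs simp: arc_to_ends_def)
  moreover have "v \<notin> {u \<in> verts G. (v, u) \<in> arcs_ends G}"
    using adj_not_same by blast
  ultimately show ?thesis
    by (simp add: closed_nbhd_def card_insert_disjoint finite_out_arcs out_degree_def card_image)
qed

lemma min_degree_le: "v \<in> verts G \<Longrightarrow> min_degree G \<le> out_degree G v"
  by (simp add: min_degree_def)

lemma max_degree_attained:
  assumes "verts G \<noteq> {}"
  obtains v where "v \<in> verts G" "out_degree G v = max_degree G"
proof -
  have "max_degree G \<in> out_degree G ` verts G"
    unfolding max_degree_def using assms by (intro Max_in) auto
  then show thesis using that by auto
qed

lemma finite_dominating_sets: "finite {D. dominating_set G D}"
  by (rule finite_subset[of _ "Pow (verts G)"]) (auto simp: dominating_set_def)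

lemma domination_number_le: "dominating_set G D \<Longrightarrow> domination_number G \<le> card D"
  unfolding domination_number_def using finite_dominating_sets by (intro Min_le) auto

lemma domination_number_add_le_card:
  assumes "verts G \<noteq> {}" and P: "P \<subseteq> verts G"
    and k: "\<And>v. v \<in> verts G \<Longrightarrow> k < card (closed_nbhd G v \<inter> P)"
  shows "domination_number G + k \<le> card P"
proof -
  have fin: "finite P" using P finite_verts finite_subset by blast
  \<comment> \<open>Any one vertex yields \<open>k \<le> card P\<close>, so that \<open>k\<close>
    vertices can be removed from \<open>P\<close>.\<close>
  obtain w where "w \<in> verts G" using assms(1) by blast
  then have "k < card (closed_nbhd G w \<inter> P)" by (rule k)
  also have "\<dots> \<le> card P" using fin by (intro card_mono) auto
  finally have "k \<le> card P" by simp
  then obtain S where S: "S \<subseteq> P" "card S = k" "finite S"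
    using obtain_subset_with_card_n by metis
  have "dominating_set G (P - S)"
    unfolding dominating_set_def
  proof (intro conjI ballI)
    fix v assume v: "v \<in> verts G - (P - S)"
    \<comment> \<open>Since \<open>S\<close> has only \<open>k\<close> elements, some
      \<open>u\<close> in the closed neighbourhood lies in \<open>P - S\<close>. As \<open>v\<close>
      itself does not, \<open>u\<close> is a proper neighbour of \<open>v\<close>.\<close>
    have "\<not> closed_nbhd G v \<inter> P \<subseteq> S"
      using k[of v] v S card_mono[of S "closed_nbhd G v \<inter> P"] by fastforce
    with v show "\<exists>u\<in>P - S. (v, u) \<in> arcs_ends G"
      by (auto simp: closed_nbhd_def)
  qed (use P in blast)
  then have "domination_number G \<le> card (P - S)" by (rule domination_number_le)
  then show ?thesis using S fin \<open>k \<le> card P\<close> by (simp add: card_Diff_subset)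
qed

lemma signed_dominating_function_weight:
  assumes "signed_dominating_function G f"
  shows "sum f (verts G) = 2 * int (card {v \<in> verts G. f v = 1}) - int (card (verts G))"
  using assms by (intro sum_sign_eq_card) (auto simp: signed_dominating_function_def)

text \<open>With \<open>p\<close> positive vertices, the sum over the closed neighbourhood is
  \<open>2p - (deg v + 1)\<close>, and it is at least 1. The 2 thus combines \<open>v\<close> itself
  with the lower bound 1.\<close>

lemma out_degree_le_card_positive_nbhd:
  assumes f: "signed_dominating_function G f" and v: "v \<in> verts G"
  shows "out_degree G v + 2 \<le> 2 * card (closed_nbhd G v \<inter> {u \<in> verts G. f u = 1})"
proof -
  note sub = closed_nbhd_subset_verts[OF v]
  have "sum f (closed_nbhd G v) =
      2 * int (card {u \<in> closed_nbhd G v. f u = 1}) - int (card (closed_nbhd G v))"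
    using f sub by (intro sum_sign_eq_card) (auto simp: signed_dominating_function_def)
  moreover have "{u \<in> closed_nbhd G v. f u = 1} = closed_nbhd G v \<inter> {u \<in> verts G. f u = 1}"
    using sub by auto
  moreover have "sum f (closed_nbhd G v) \<ge> 1"
    using f v by (simp add: signed_dominating_function_def)
  ultimately show ?thesis by (simp add: card_closed_nbhd)
qed

lemma signed_dominating_function_weight_ge:
  assumes ne: "verts G \<noteq> {}" and f: "signed_dominating_function G f"
  shows "sum f (verts G) \<ge> - int (card (verts G)) +
      2 * max \<lceil>(real (max_degree G) + 2) / 2\<rceil>
              \<lceil>(real (min_degree G) + 2 * real (domination_number G)) / 2\<rceil>"
proof -
  define P where "P = {v \<in> verts G. f v = 1}"
  note nbhd = out_degree_le_card_positive_nbhd[OF f, folded P_def]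
  obtain w where w: "w \<in> verts G" "out_degree G w = max_degree G"
    using max_degree_attained[OF ne] .
  have "card (closed_nbhd G w \<inter> P) \<le> card P"
    by (intro card_mono) (auto simp: P_def)
  with nbhd[OF w(1)] w(2) have "max_degree G + 2 \<le> 2 * card P" by simp
  from ceiling_half_le[OF this]
  have max: "\<lceil>(real (max_degree G) + 2) / 2\<rceil> \<le> int (card P)" by (simp add: add.commute)
  \<comment> \<open>Here \<open>k = (min_degree G + 1) div 2\<close> is half the minimum degree,
    rounded up. Since \<open>2k \<le> min_degree G + 1\<close>, the neighbourhood bound exceeds
    \<open>2k\<close>; since \<open>2k \<ge> min_degree G\<close>, doubling the inequality gives the
    second term.\<close>
  have "domination_number G + (min_degree G + 1) div 2 \<le> card P"
  proof (rule domination_number_add_le_card[OF ne])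
    show "P \<subseteq> verts G" by (auto simp: P_def)
    show "(min_degree G + 1) div 2 < card (closed_nbhd G v \<inter> P)" if "v \<in> verts G" for v
      using nbhd[OF that] min_degree_le[OF that] by linarith
  qed
  then have "min_degree G + 2 * domination_number G \<le> 2 * card P" by linarith
  from ceiling_half_le[OF this]
  have "\<lceil>(real (min_degree G) + 2 * real (domination_number G)) / 2\<rceil> \<le> int (card P)"
    by simp
  with max signed_dominating_function_weight[OF f, folded P_def] show ?thesis by linarith
qed

text \<open>Values off the vertex set are free, so the functions themselves may be infinitely many;
  their weights lie in a bounded integer interval, which makes the \<open>Min\<close>
  meaningful.\<close>

lemma finite_signed_dominating_weights:
  "finite ((\<lambda>f. sum f (verts G)) ` {f. signed_dominating_function G f})"
proof (rule finite_subset)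
  show "(\<lambda>f. sum f (verts G)) ` {f. signed_dominating_function G f}
      \<subseteq> {- int (card (verts G))..int (card (verts G))}"
  proof safe
    fix f assume "signed_dominating_function G f"
    note w = signed_dominating_function_weight[OF this]
    have "card {v \<in> verts G. f v = 1} \<le> card (verts G)"
      by (intro card_mono) auto
    with w show "sum f (verts G) \<in> {- int (card (verts G))..int (card (verts G))}" by simp
  qed
qed simp

lemma signed_domination_number_le:
  "signed_dominating_function G f \<Longrightarrow> signed_domination_number G \<le> sum f (verts G)"
  unfolding signed_domination_number_def
  using finite_signed_dominating_weights by (intro Min_le) auto

lemma signed_domination_number_attained:
  obtains f where "signed_dominating_function G f" "sum f (verts G) = signed_domination_number G"
proof -
  have "signed_dominating_function G (\<lambda>_. 1)"
    by (simp add: signed_dominating_function_def card_closed_nbhd)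
  then have "signed_domination_number G
      \<in> (\<lambda>f. sum f (verts G)) ` {f. signed_dominating_function G f}"
    unfolding signed_domination_number_def
    using finite_signed_dominating_weights by (intro Min_in) auto
  then show thesis using that by auto
qed

lemma signed_domination_number_ge:
  assumes "verts G \<noteq> {}"
  shows "signed_domination_number G \<ge> - int (card (verts G)) +
      2 * max \<lceil>(real (max_degree G) + 2) / 2\<rceil>
              \<lceil>(real (min_degree G) + 2 * real (domination_number G)) / 2\<rceil>"
  using signed_dominating_function_weight_ge[OF assms] signed_domination_number_attained by metis

text \<open>All neighbourhood conditions collapse to the single one that the total weight be at
  least 1. The least \<open>p\<close> with \<open>2p - n \<ge> 1\<close> is
  \<open>n div 2 + 1\<close>.\<close>

lemma signed_domination_number_le_if_complete:
  assumes ne: "verts G \<noteq> {}"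
    and nbhd: "\<And>v. v \<in> verts G \<Longrightarrow> closed_nbhd G v = verts G"
  shows "signed_domination_number G \<le> 2 * int (card (verts G) div 2 + 1) - int (card (verts G))"
proof -
  have "card (verts G) > 0" using ne by (simp add: card_gt_0_iff)
  then have "card (verts G) div 2 + 1 \<le> card (verts G)" by linarith
  then obtain P where P: "P \<subseteq> verts G" "card P = card (verts G) div 2 + 1"
    using obtain_subset_with_card_n by metis
  define f :: "'a \<Rightarrow> int" where "f v = (if v \<in> P then 1 else -1)" for v
  have "{v \<in> verts G. f v = 1} = P" using P(1) by (auto simp: f_def)
  then have w: "sum f (verts G) = 2 * int (card (verts G) div 2 + 1) - int (card (verts G))"
    using sum_sign_eq_card[of "verts G" f] P(2) by (simp add: f_def)
  \<comment> \<open>The weight is 1 for odd order and 2 for even order.\<close>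
  then have "sum f (verts G) \<ge> 1" by presburger
  then have "signed_dominating_function G f"
    by (simp add: signed_dominating_function_def nbhd) (simp add: f_def)
  from signed_domination_number_le[OF this] w show ?thesis by simp
qed

end

text \<open>The upper bound for complete graphs is the claimed expression with the maximum replaced
  by its first term, hence at most that expression; the general lower bound closes the gap.\<close>

lemma complete_digraph_signed_domination_number:
  assumes "complete_digraph n G" and "n \<ge> 1"
  shows "signed_domination_number G = - int n +
      2 * max \<lceil>(real (max_degree G) + 2) / 2\<rceil>
              \<lceil>(real (min_degree G) + 2 * real (domination_number G)) / 2\<rceil>"
proof -
  interpret graph G using assms(1) by (simp add: complete_digraph_def)
  have n: "card (verts G) = n" using assms(1) by (simp add: complete_digraph_def)
  then have ne: "verts G \<noteq> {}" using assms(2) by auto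
  have nbhd: "closed_nbhd G v = verts G" if "v \<in> verts G" for v
    using assms(1) that by (auto simp: complete_digraph_def closed_nbhd_def)
  obtain w where w: "w \<in> verts G" "out_degree G w = max_degree G"
    using max_degree_attained[OF ne] .
  then have "max_degree G + 1 = n"
    using card_closed_nbhd[of w] n nbhd by simp
  then have "(real (max_degree G) + 2) / 2 = (real n + 1) / 2" by auto
  then have "int (n div 2 + 1) = \<lceil>(real (max_degree G) + 2) / 2\<rceil>"
    by (simp only: ceiling_Suc_half)
  then show ?thesis
    using signed_domination_number_ge[OF ne] signed_domination_number_le_if_complete[OF ne] nbhd n
    by force
qed

theorem theorem3p3:
  shows "(\<forall>G :: ('a, 'b) pre_digraph. graph G \<and> connected G \<longrightarrow>
            signed_domination_number G \<ge>
              - int (card (verts G)) +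
              2 * max \<lceil>(real (max_degree G) + 2) / 2\<rceil>
                      \<lceil>(real (min_degree G) + 2 * real (domination_number G)) / 2\<rceil>)
       \<and> (\<forall>n \<ge> 1. \<forall>G :: ('a, 'b) pre_digraph. complete_digraph n G \<longrightarrow>
            signed_domination_number G =
              - int n +
              2 * max \<lceil>(real (max_degree G) + 2) / 2\<rceil>
                      \<lceil>(real (min_degree G) + 2 * real (domination_number G)) / 2\<rceil>)"
proof (intro conjI allI impI)
  fix G :: "('a, 'b) pre_digraph"
  assume G: "graph G \<and> connected G"
  then interpret graph G by simp
  have "verts G \<noteq> {}" using G by (auto simp: connected_def strongly_connected_def)
  then show "signed_domination_number G \<ge>
              - int (card (verts G)) +
              2 * max \<lceil>(real (max_degree G) + 2) / 2\<rceil>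
                      \<lceil>(real (min_degree G) + 2 * real (domination_number G)) / 2\<rceil>"
    by (rule signed_domination_number_ge)
qed (rule complete_digraph_signed_domination_number)

end
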